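(* Let $N\ge 1$, let $u(1),\dots,u(N)\in\mathbb{R}$ be known inputs and $\mathbf{y}=[y(1),\dots,y(N)]^\top$ the observed outputs of the system $\mathbf{y}=\mathbf{H}\mathbf{g}_\star+\mathbf{e}$, where $\mathbf{H}\in\mathbb{R}^{N\times N}$ is the lower-triangular Toeplitz matrix with entries $\mathbf{H}_{i,j}=u(i-j+1)$ for $j\le i$ and $\mathbf{H}_{i,j}=0$ for $j>i$, $\mathbf{g}_\star$ is the vector of the first $N$ impulse response coefficients of the unknown system, and $\mathbf{e}$ has mean zero and covariance $\lambda\mathbf{I}$. Let $\mathbf{g}_\theta\in\mathbb{R}^N$ be the vector of the first $N$ impulse response coefficients of the parametric model with parameter $\theta$. For a vector $\bar{\mathbf{g}}$, a weight matrix $\mathbf{W}\succeq\mathbf{0}$ and a covariance matrix $\mathbf{\Sigma}$ not depending on $\theta$, consider the decision rule $$\widehat{\theta}=\arg\min_{\theta}\mathcal{R}(\theta),\qquad \mathcal{R}(\theta)=\tfrac12\operatorname{tr}(\mathbf{W}\mathbf{\Sigma})+\tfrac12\|\bar{\mathbf{g}}-\mathbf{g}_\theta\|_{\mathbf{W}}^2 .$$ Suppose we let $\bar{\mathbf{g}}$ be the unbiased least squares estimate of $\mathbf{g}_\star$ and take $\mathbf{W}$ to be its precision matrix, i.e., $$\bar{\mathbf{g}}=\mathbf{H}^{\dagger}\mathbf{y}\qquad\text{and}\qquad \mathbf{W}=\lambda^{-1}\mathbf{H}^\top\mathbf{H}.$$ Then this decision rule corresponds to the prediction error method (PEM), that is,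 $$\arg\min_{\theta}\mathcal{R}(\theta)=\arg\min_{\theta}\tfrac12\|\mathbf{y}-\mathbf{H}\mathbf{g}_\theta\|^2 .$$ Moreover, the variance $\lambda$ does not affect the decision and can therefore be set to unity.
   Context: The data are generated by a discrete, linear time-invariant, causal single-input single-output system $y(t)=\sum_{k=0}^{t-1}g_\star(k)u(t-k)+e(t)$, $t=1,\dots,N$, with $u(t)=0$ for $t\le 0$ and $e(t)$ a zero-mean white disturbance with variance $\lambda$; in vector form $\mathbf{y}=\mathbf{H}\mathbf{g}_\star+\mathbf{e}$ with $\mathbf{g}_\star=[g_\star(0),\dots,g_\star(N-1)]^\top$ and $\mathbf{e}=[e(1),\dots,e(N)]^\top$. A family of impulse responses $g_\theta$ parameterized by a vector $\theta$ is given (for example, those of rational transfer functions with coefficients collected in $\theta$), and $\mathbf{g}_\theta=[g_\theta(0),\dots,g_\theta(N-1)]^\top$. The true impulse response $g_\star$ does not have to belong to this family. The weighted norm is $\|\mathbf{v}\|_{\mathbf{W}}=\sqrt{\mathbf{v}^\top\mathbf{W}\mathbf{v}}$, and $\|\cdot\|$ is the Euclidean norm. $\mathbf{H}^\dagger$ is the (Moore–Penrose) pseudoinverse of $\mathbf{H}$. The risk $\mathcal{R}(\theta)$ is the expectation of the loss $\frac12\|\mathbf{g}-\mathbf{g}_\theta\|_{\mathbf{W}}^2$ when $\mathbf{g}$ is a random impulse response vector with mean $\bar{\mathbf{g}}$ and covariance matrix $\mathbf{\Sigma}$ given the data. The prediction error method chooses $\theta$ minimizing $\frac12\|\mathbf{y}-\widetilde{\mathbf{y}}_\theta\|^2$,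 where $\widetilde{\mathbf{y}}_\theta=\mathbf{H}\mathbf{g}_\theta$ is the output predicted by the parametric model given the input. *)

theory Defs
  imports "HOL-Probability.Probability"
begin

(* Vectors of length N are elements of real^'n with N = CARD('n).  The order on 'n is only used
   to number the indices 1, ..., N: the index i is the (pos i)-th one. *)
definition pos :: "'n::{finite,linorder} \<Rightarrow> nat" where
  "pos i = card {..i}"

definition input_matrix :: "(nat \<Rightarrow> real) \<Rightarrow> real^'n::{finite,linorder}^'n::{finite,linorder}" where
  "input_matrix u = (\<chi> i j. if j \<le> i then u (pos i - pos j + 1) else 0)"

definition impulse_vec :: "(nat \<Rightarrow> real) \<Rightarrow> real^'n::{finite,linorder}" where
  "impulse_vec g = (\<chi> i. g (pos i - 1))"

definition wnorm :: "real^'n^'n \<Rightarrow> real^'n \<Rightarrow> real" where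
  "wnorm W v = sqrt (v \<bullet> (W *v v))"

definition is_pseudoinverse :: "real^'n^'m \<Rightarrow> real^'m^'n \<Rightarrow> bool" where
  "is_pseudoinverse A X \<longleftrightarrow>
     A ** X ** A = A \<and> X ** A ** X = X \<and>
     transpose (A ** X) = A ** X \<and> transpose (X ** A) = X ** A"

definition pseudoinverse :: "real^'n^'m \<Rightarrow> real^'m^'n" where
  "pseudoinverse A = (THE X. is_pseudoinverse A X)"

(* On a probability space, square integrability of all coordinates makes the means and covariances
   below genuine integrals rather than the default value 0. *)
definition has_mean_covariance ::
    "'w measure \<Rightarrow> ('w \<Rightarrow> real^'n) \<Rightarrow> real^'n \<Rightarrow> real^'n^'n \<Rightarrow> bool" where
  "has_mean_covariance M X m S \<longleftrightarrow>
     prob_space M \<and> X \<in> borel_measurable M \<and>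
     (\<forall>i. integrable M (\<lambda>\<omega>. (X \<omega> $ i)\<^sup>2)) \<and>
     (\<forall>i. (LINT \<omega>|M. X \<omega> $ i) = m $ i) \<and>
     (\<forall>i j. (LINT \<omega>|M. (X \<omega> $ i - m $ i) * (X \<omega> $ j - m $ j)) = S $ i $ j)"

definition risk ::
    "(real^'n::{finite,linorder}) measure \<Rightarrow> real^'n::{finite,linorder}^'n::{finite,linorder} \<Rightarrow> ('p \<Rightarrow> nat \<Rightarrow> real) \<Rightarrow> 'p \<Rightarrow> real" where
  "risk P W gm \<theta> = (LINT g|P. (1/2) * (wnorm W (g - impulse_vec (gm \<theta>)))\<^sup>2)"

definition arg_min_set :: "('p \<Rightarrow> real) \<Rightarrow> 'p set \<Rightarrow> 'p set" where
  "arg_min_set f T = {\<theta>. is_arg_min f (\<lambda>\<theta>. \<theta> \<in> T) \<theta>}"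

lemma pos_bounds: "1 \<le> pos (i::'n::{finite,linorder})" "pos i \<le> CARD('n)"
  unfolding pos_def by (auto intro: card_mono simp: Suc_le_eq card_gt_0_iff)

lemma pos_less_iff: "pos i < pos j \<longleftrightarrow> i < (j::'n::{finite,linorder})"
proof -
  have mono: "pos i < pos j" if "i < j" for i j :: 'n
    unfolding pos_def using that by (intro psubset_card_mono) auto
  show ?thesis
    using mono[of i j] mono[of j i] by (metis less_asym linorder_neqE less_irrefl)
qed

lemma bij_betw_pos: "bij_betw pos (UNIV :: 'n::{finite,linorder} set) {1..CARD('n)}"
proof -
  have inj: "inj (pos :: 'n \<Rightarrow> nat)"
    by (rule injI) (metis less_irrefl linorder_neqE pos_less_iff)
  have "range (pos :: 'n \<Rightarrow> nat) = {1..CARD('n)}"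
    by (rule card_subset_eq) (use pos_bounds in \<open>auto simp: card_image inj\<close>)
  with inj show ?thesis by (simp add: bij_betw_def)
qed

lemma is_pseudoinverse_unique:
  assumes "is_pseudoinverse A X" "is_pseudoinverse A Y"
  shows "X = Y"
proof -
  note x = assms(1)[unfolded is_pseudoinverse_def]
  note y = assms(2)[unfolded is_pseudoinverse_def]
  have ax: "A ** X = A ** Y"
  proof -
    have "A ** X = transpose (A ** Y ** (A ** X))"
      using x y by (metis matrix_mul_assoc)
    also have "\<dots> = A ** X ** (A ** Y)"
      using x y by (simp only: matrix_transpose_mul)
    also have "\<dots> = A ** Y"
      using x by (metis matrix_mul_assoc)
    finally show ?thesis .
  qed
  have xa: "X ** A = Y ** A"
  proof -
    have "X ** A = transpose (X ** A ** (Y ** A))"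
      using x y by (metis matrix_mul_assoc)
    also have "\<dots> = Y ** A ** (X ** A)"
      using x y by (simp only: matrix_transpose_mul)
    also have "\<dots> = Y ** A"
      using x by (metis matrix_mul_assoc)
    finally show ?thesis .
  qed
  show ?thesis using x y ax xa by (metis matrix_mul_assoc)
qed

lemma generalized_inverse_exists:
  fixes A :: "real^'n^'m"
  shows "\<exists>G. A ** G ** A = A"
proof -
  obtain g where g: "range g \<subseteq> UNIV" "linear g" "\<forall>v\<in>range ((*v) A). A *v g v = v"
    using linear_exists_right_inverse_on[of "(*v) A" UNIV] by auto
  have "A ** matrix g ** A = A"
    unfolding matrix_eq using g(3)
    by (simp add: matrix_vector_mul_assoc[symmetric] matrix_works[of g] g(2) linear_matrix_vector_mul_eq)
  then show ?thesis by blast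
qed

lemma transpose_mult_self_eq_0:
  fixes B :: "real^'n^'m"
  assumes "transpose B ** B = 0"
  shows "B = 0"
proof -
  have "B *v x = 0" for x
  proof -
    have "(B *v x) \<bullet> (B *v x) = x \<bullet> ((transpose B ** B) *v x)"
      by (metis dot_lmul_matrix matrix_vector_mul_assoc transpose_matrix_vector inner_commute)
    then show ?thesis using assms by simp
  qed
  then show ?thesis by (simp add: matrix_eq)
qed

lemma matrix_mult_diff_ldistrib:
  fixes A :: "real^'n^'m"
  shows "A ** (B - C) = A ** B - A ** C"
  by (simp add: matrix_eq matrix_vector_mul_assoc[symmetric] algebra_simps)

lemma least_squares_inverse_exists:
  fixes A :: "real^'n^'m"
  shows "\<exists>X. A ** X ** A = A \<and> transpose (A ** X) = A ** X"
proof -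
  let ?B = "transpose A ** A"
  obtain G where G: "?B ** G ** ?B = ?B" using generalized_inverse_exists by blast
  let ?X = "G ** transpose A"
  let ?D = "A ** ?X ** A - A"
  have "transpose A ** ?D = 0"
    using G by (simp add: matrix_mul_assoc matrix_mult_diff_ldistrib)
  moreover have "?D = A ** (?X ** A - mat 1)"
    by (simp add: matrix_mult_diff_ldistrib matrix_mul_assoc)
  ultimately have "transpose ?D ** ?D = transpose (?X ** A - mat 1) ** 0"
    by (metis matrix_transpose_mul matrix_mul_assoc)
  also have "\<dots> = 0"
    by (simp add: matrix_eq matrix_vector_mul_assoc[symmetric])
  finally have "transpose ?D ** ?D = 0" .
  then have axa: "A ** ?X ** A = A"
    using transpose_mult_self_eq_0 by fastforce
  have "A ** ?X = A ** G ** transpose (A ** ?X ** A)"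
    using axa by (simp add: matrix_mul_assoc)
  also have "\<dots> = (A ** ?X ** A) ** transpose G ** transpose A"
    by (simp add: matrix_transpose_mul matrix_mul_assoc)
  also have "\<dots> = transpose (A ** ?X)"
    unfolding axa by (simp add: matrix_transpose_mul matrix_mul_assoc)
  finally show ?thesis using axa by metis
qed

lemma is_pseudoinverse_exists: "\<exists>X. is_pseudoinverse A X"
proof -
  obtain X where X: "A ** X ** A = A" "transpose (A ** X) = A ** X"
    using least_squares_inverse_exists by blast
  obtain Z where Z: "transpose A ** Z ** transpose A = transpose A"
      "transpose (transpose A ** Z) = transpose A ** Z"
    using least_squares_inverse_exists by blast
  define Y where "Y = transpose Z"
  have Y: "A ** Y ** A = A" "transpose (Y ** A) = Y ** A"
    unfolding Y_def using Z
    by (metis matrix_transpose_mul matrix_mul_assoc transpose_transpose)+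
  have 1: "A ** (Y ** A ** X) = A ** X" "Y ** A ** X ** A = Y ** A"
    using X Y by (metis matrix_mul_assoc)+
  have "Y ** A ** X ** A ** (Y ** A ** X) = Y ** A ** X"
    using 1 X Y by (metis matrix_mul_assoc)
  then have "is_pseudoinverse A (Y ** A ** X)"
    unfolding is_pseudoinverse_def using 1 X Y by simp
  then show ?thesis by blast
qed

lemma is_pseudoinverse_pseudoinverse: "is_pseudoinverse A (pseudoinverse A)"
  unfolding pseudoinverse_def
  using is_pseudoinverse_exists is_pseudoinverse_unique by (metis theI')

end

(* The risk splits into the constant (1/2) tr (W S) and the squared W-distance from g_bar to the
   model.  For W = c H^T H this distance is c |H g_bar - H g|^2, and H g_bar is the orthogonal
   projection of y onto the range of H, so by Pythagoras it differs from c |y - H g|^2 by a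
   constant.  The risk is thus a strictly increasing affine function of the PEM criterion. *)

theory Submission
  imports Defs
begin

text \<open>\<open>is_arg_min\<close> depends only on strict comparisons between values, and these
  survive scaling by a positive constant and a shift. Both sets may be empty.\<close>

lemma arg_min_set_affine:
  assumes "c > 0" and "\<And>\<theta>. f \<theta> = a + c * g \<theta>"
  shows "arg_min_set f T = arg_min_set g T"
  using assms by (simp add: arg_min_set_def is_arg_min_def)

lemma inner_matrix_vector_mult_sum:
  fixes W :: "real^'n^'n"
  shows "v \<bullet> (W *v v) = (\<Sum>i\<in>UNIV. \<Sum>j\<in>UNIV. W $ i $ j * (v $ i * v $ j))"
  by (simp add: inner_vec_def matrix_vector_mult_def sum_distrib_left mult_ac)

lemma inner_gram:
  fixes H :: "real^'n^'m"
  shows "v \<bullet> ((c *\<^sub>R (transpose H ** H)) *v v) = c * (norm (H *v v))\<^sup>2"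
proof -
  have "v \<bullet> (transpose H *v (H *v v)) = (norm (H *v v))\<^sup>2"
    using dot_lmul_matrix[of "H *v v" H v] by (simp add: power2_norm_eq_inner inner_commute)
  then show ?thesis
    by (simp only: scaleR_matrix_vector_assoc[symmetric] matrix_vector_mul_assoc[symmetric]
        inner_scaleR_right)
qed

text \<open>The products centred at \<open>a\<close> and at \<open>m\<close> expand into the same
  raw moments, so their integrals differ only by a polynomial in the means. The centre
  \<open>a\<close> is arbitrary so that a model response can take its place.\<close>

lemma has_mean_covariance_second_moment:
  fixes X :: "'w \<Rightarrow> real^'n"
  assumes "has_mean_covariance M X m S"
  shows "integrable M (\<lambda>\<omega>. (X \<omega> $ i - a $ i) * (X \<omega> $ j - a $ j))"
    and "(LINT \<omega>|M. (X \<omega> $ i - a $ i) * (X \<omega> $ j - a $ j)) =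
           S $ i $ j + (m $ i - a $ i) * (m $ j - a $ j)"
proof -
  interpret prob_space M
    using assms by (simp add: has_mean_covariance_def)
  have meas: "X \<in> borel_measurable M"
    and sq: "\<And>k. integrable M (\<lambda>\<omega>. (X \<omega> $ k)\<^sup>2)"
    and mean: "\<And>k. (LINT \<omega>|M. X \<omega> $ k) = m $ k"
    and cov: "\<And>k l. (LINT \<omega>|M. (X \<omega> $ k - m $ k) * (X \<omega> $ l - m $ l)) = S $ k $ l"
    using assms by (auto simp: has_mean_covariance_def)
  have meas_comp [measurable]: "(\<lambda>\<omega>. X \<omega> $ k) \<in> borel_measurable M" for k
    by (rule measurable_compose[OF meas]) (intro borel_measurable_continuous_onI continuous_intros)
  have int: "integrable M (\<lambda>\<omega>. X \<omega> $ k)" for k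
    by (rule square_integrable_imp_integrable[OF meas_comp sq])
  have int2: "integrable M (\<lambda>\<omega>. X \<omega> $ k * X \<omega> $ l)" for k l
  proof (rule Bochner_Integration.integrable_bound)
    show "integrable M (\<lambda>\<omega>. (X \<omega> $ k)\<^sup>2 + (X \<omega> $ l)\<^sup>2)"
      using sq by simp
    \<comment> \<open>From 2|x||y| \<le> |x|^2 + |y|^2, dropping one nonnegative |xy|.\<close>
    have "\<bar>x * y\<bar> \<le> x\<^sup>2 + y\<^sup>2" for x y :: real
      using sum_squares_bound[of "\<bar>x\<bar>" "\<bar>y\<bar>"] abs_ge_zero[of "x * y"]
      by (simp only: abs_mult power2_abs)
    then show "AE \<omega> in M. norm (X \<omega> $ k * X \<omega> $ l) \<le> norm ((X \<omega> $ k)\<^sup>2 + (X \<omega> $ l)\<^sup>2)"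
      by simp
  qed simp
  have expand: "(X \<omega> $ i - b $ i) * (X \<omega> $ j - b $ j) =
      X \<omega> $ i * X \<omega> $ j - b $ j * X \<omega> $ i - b $ i * X \<omega> $ j + b $ i * b $ j" for \<omega> b
    by (simp add: algebra_simps)
  show "integrable M (\<lambda>\<omega>. (X \<omega> $ i - a $ i) * (X \<omega> $ j - a $ j))"
    unfolding expand using int int2 by simp
  have moment: "(LINT \<omega>|M. (X \<omega> $ i - b $ i) * (X \<omega> $ j - b $ j)) =
      (LINT \<omega>|M. X \<omega> $ i * X \<omega> $ j) - b $ j * m $ i - b $ i * m $ j + b $ i * b $ j" for b
    unfolding expand using int int2 by (simp add: mean prob_space)
  show "(LINT \<omega>|M. (X \<omega> $ i - a $ i) * (X \<omega> $ j - a $ j)) =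
      S $ i $ j + (m $ i - a $ i) * (m $ j - a $ j)"
    \<comment> \<open>Once \<open>S $ i $ j\<close> is turned back into an integral,
      \<open>moment\<close> applies with both \<open>b = a\<close> and \<open>b = m\<close>, and the
      raw second moment cancels.\<close>
    unfolding cov[of i j, symmetric] moment by (simp add: algebra_simps)
qed

lemma covariance_symmetric:
  assumes "has_mean_covariance M X m S"
  shows "S $ i $ j = S $ j $ i"
proof -
  have "(LINT \<omega>|M. (X \<omega> $ k - m $ k) * (X \<omega> $ l - m $ l)) = S $ k $ l" for k l
    using assms by (simp add: has_mean_covariance_def)
  from this[of i j] this[of j i] show ?thesis
    by (simp add: mult.commute)
qed

lemma expectation_quadratic_form:
  fixes X :: "'w \<Rightarrow> real^'n"
  assumes "has_mean_covariance M X m S"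
  shows "(LINT \<omega>|M. (X \<omega> - a) \<bullet> (W *v (X \<omega> - a))) = trace (W ** S) + (m - a) \<bullet> (W *v (m - a))"
proof -
  \<comment> \<open>The trace pairs \<open>W $ i $ j\<close> with \<open>S $ j $ i\<close>; symmetry
    of the covariance aligns the indices with those of the quadratic form.\<close>
  have "trace (W ** S) = (\<Sum>i\<in>UNIV. \<Sum>j\<in>UNIV. W $ i $ j * S $ i $ j)"
    unfolding trace_def matrix_matrix_mult_def
    by (simp add: covariance_symmetric[OF assms])
  then show ?thesis
    unfolding inner_matrix_vector_mult_sum
    by (simp add: has_mean_covariance_second_moment[OF assms] Bochner_Integration.integral_sum
        sum.distrib distrib_left)
qed

text \<open>Bias-variance split. Nonnegativity of the form ensures that squaring the root in
  \<open>wnorm\<close> returns the form itself; for a negative value it would give the absolute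
  value.\<close>

lemma risk_eq:
  assumes "has_mean_covariance P (\<lambda>g. g) m S" and psd: "\<And>v. v \<bullet> (W *v v) \<ge> 0"
  shows "risk P W gm \<theta> =
    (1/2) * trace (W ** S) + (1/2) * (wnorm W (m - impulse_vec (gm \<theta>)))\<^sup>2"
  using expectation_quadratic_form[OF assms(1), of "impulse_vec (gm \<theta>)" W]
  by (simp add: risk_def wnorm_def psd add_divide_distrib)

lemma pseudoinverse_pythagoras:
  fixes A :: "real^'n^'m"
  shows "(norm (y - A *v x))\<^sup>2 =
    (norm (y - A *v (pseudoinverse A *v y)))\<^sup>2 + (norm (A *v (pseudoinverse A *v y - x)))\<^sup>2"
proof -
  let ?X = "pseudoinverse A"
  let ?r = "y - A *v (?X *v y)"
  have X: "A ** ?X ** A = A" "transpose (A ** ?X) = A ** ?X"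
    using is_pseudoinverse_pseudoinverse[of A] by (auto simp: is_pseudoinverse_def)
  \<comment> \<open>The normal equations for all \<open>y\<close> at once: transpose
    \<open>A ** ?X ** A = A\<close> and use that \<open>A ** ?X\<close> is symmetric. The rank of
    \<open>A\<close> is arbitrary.\<close>
  have "transpose A ** (A ** ?X) = transpose A"
    using X by (metis matrix_transpose_mul)
  then have "transpose A *v ?r = 0"
    by (simp add: matrix_vector_mult_diff_distrib matrix_vector_mul_assoc matrix_mul_assoc)
  then have "orthogonal ?r (A *v z)" for z
    by (metis dot_lmul_matrix inner_zero_left orthogonal_def transpose_matrix_vector)
  moreover have "y - A *v x = ?r + A *v (?X *v y - x)"
    by (simp add: matrix_vector_mult_diff_distrib)
  ultimately show ?thesis
    by (metis norm_add_Pythagorean)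
qed

text \<open>Neither \<open>c\<close> nor \<open>S\<close> occurs on the right-hand side; this is why
  the noise variance cannot influence the decision.\<close>

lemma arg_min_set_risk_gram:
  fixes H :: "real^'n::{finite,linorder}^'n::{finite,linorder}"
  assumes P: "has_mean_covariance P (\<lambda>g. g) (pseudoinverse H *v y) S" and "c > 0"
  shows "arg_min_set (risk P (c *\<^sub>R (transpose H ** H)) gm) T =
    arg_min_set (\<lambda>\<theta>. (1/2) * (norm (y - H *v impulse_vec (gm \<theta>)))\<^sup>2) T"
proof (rule arg_min_set_affine[OF \<open>c > 0\<close>])
  let ?W = "c *\<^sub>R (transpose H ** H)"
  fix \<theta>
  have "(wnorm ?W v)\<^sup>2 = c * (norm (H *v v))\<^sup>2" for v
    using \<open>c > 0\<close> by (simp add: wnorm_def inner_gram)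
  moreover have "v \<bullet> (?W *v v) \<ge> 0" for v
    using \<open>c > 0\<close> by (simp add: inner_gram)
  \<comment> \<open>The subtracted constant is the part of the PEM criterion due to the least
    squares residual, scaled by \<open>c\<close>.\<close>
  ultimately show "risk P ?W gm \<theta> =
    ((1/2) * trace (?W ** S) - c * ((1/2) * (norm (y - H *v (pseudoinverse H *v y)))\<^sup>2)) +
    c * ((1/2) * (norm (y - H *v impulse_vec (gm \<theta>)))\<^sup>2)"
    unfolding pseudoinverse_pythagoras[of y H "impulse_vec (gm \<theta>)"]
    by (simp add: risk_eq[OF P] distrib_left)
qed

theorem mainTheorem1:
  fixes u :: "nat \<Rightarrow> real"
    and H :: "real^'n::{finite,linorder}^'n::{finite,linorder}"
    and lam :: real
    and M :: "'w measure" and e :: "'w \<Rightarrow> real^'n::{finite,linorder}" and \<omega> :: 'w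
    and g_star :: "nat \<Rightarrow> real"
    and y :: "real^'n::{finite,linorder}"
    and \<Theta> :: "(real^'p) set" and g_model :: "real^'p \<Rightarrow> nat \<Rightarrow> real"
    and g_bar :: "real^'n::{finite,linorder}" and W \<Sigma> :: "real^'n::{finite,linorder}^'n::{finite,linorder}"
    and P :: "(real^'n::{finite,linorder}) measure"
  assumes "H = input_matrix u"
    and "lam > 0"
    and "has_mean_covariance M e 0 (lam *\<^sub>R mat 1)"
    and "\<omega> \<in> space M"
    and "y = H *v impulse_vec g_star + e \<omega>"
    and "has_mean_covariance P (\<lambda>g. g) g_bar \<Sigma>"
    and "g_bar = pseudoinverse H *v y"
    and "W = inverse lam *\<^sub>R (transpose H ** H)"
  shows
    "(\<forall>\<theta>. risk P W g_model \<theta> =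
        (1/2) * trace (W ** \<Sigma>) + (1/2) * (wnorm W (g_bar - impulse_vec (g_model \<theta>)))\<^sup>2) \<and>
     (arg_min_set (risk P W g_model) \<Theta> =
        arg_min_set (\<lambda>\<theta>. (1/2) * (norm (y - H *v impulse_vec (g_model \<theta>)))\<^sup>2) \<Theta>) \<and>
     (\<forall>\<mu>>0. \<forall>P' \<Sigma>'. has_mean_covariance P' (\<lambda>g. g) g_bar \<Sigma>' \<longrightarrow>
        arg_min_set (risk P' (inverse \<mu> *\<^sub>R (transpose H ** H)) g_model) \<Theta> =
        arg_min_set (risk P W g_model) \<Theta>) \<and>
     (arg_min_set (risk P (transpose H ** H) g_model) \<Theta> =
        arg_min_set (risk P W g_model) \<Theta>)"
proof -
  have c: "inverse lam > 0"
    using assms(2) by simp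
  have P: "has_mean_covariance P (\<lambda>g. g) (pseudoinverse H *v y) \<Sigma>"
    using assms(6,7) by simp
  have "risk P W g_model \<theta> =
      (1/2) * trace (W ** \<Sigma>) + (1/2) * (wnorm W (g_bar - impulse_vec (g_model \<theta>)))\<^sup>2" for \<theta>
    by (rule risk_eq[OF assms(6)]) (use c in \<open>simp add: assms(8) inner_gram\<close>)
  \<comment> \<open>The PEM set is the common reference: the scales \<open>inverse lam\<close>, 1
    (unit variance) and \<open>inverse \<mu>\<close> all lead to it, so the risk minimisers agree
    with each other.\<close>
  moreover note arg_min_set_risk_gram[OF P c, of g_model \<Theta>]
    arg_min_set_risk_gram[OF P zero_less_one, of g_model \<Theta>]
  moreover have "arg_min_set (risk P' (inverse \<mu> *\<^sub>R (transpose H ** H)) g_model) \<Theta> =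
      arg_min_set (\<lambda>\<theta>. (1/2) * (norm (y - H *v impulse_vec (g_model \<theta>)))\<^sup>2) \<Theta>"
    if "\<mu> > 0" "has_mean_covariance P' (\<lambda>g. g) g_bar \<Sigma>'" for \<mu> P' \<Sigma>'
    using that by (intro arg_min_set_risk_gram) (auto simp: assms(7))
  ultimately show ?thesis
    unfolding assms(8) scaleR_one by metis
qed

end
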